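(* Let $n\geq 3$ be an integer and let $\beta$ be an algebraic integer of degree $n$, with conjugates $\beta_{1}, \ldots, \beta_{n}$. Let $a_{1}, \ldots, a_{n} \in \mathbb{Z}$ and let $\alpha= \beta_{1}^{a_{1}} \cdots \beta_{n}^{a_{n}}$. Suppose that $\mathbb{Q}(\alpha)=\mathbb{Q}(\beta_{1},\dots,\beta_{n})$. Then $$h(\alpha) \ge \left(\frac{1}{n} \left|\sum_{i=1}^{n} a_{i}\right|\right) \cdot \log \left |N_{\mathbb{Q}(\beta)/\mathbb{Q}}(\beta) \right|.$$ In particular, if for each $n$ such data $\beta=\beta^{(n)}$, $a_i=a_i^{(n)}$ are given satisfying these hypotheses, with $\beta^{(n)}$ not a unit and $\frac{1}{n}\left|\sum_{i=1}^{n}a_{i}^{(n)}\right|\to\infty$ as $n\to\infty$, then the corresponding $h(\alpha)$ tends to infinity with $n$.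
   Context: For $\alpha\in\overline{\mathbb{Q}}$ of degree $d$ with conjugates $\alpha_1,\dots,\alpha_d$, the Mahler measure is $M(\alpha)=|a|\prod_{i=1}^d\max(1,|\alpha_i|)$, where $a$ is the leading coefficient of the minimal polynomial of $\alpha$ over $\mathbb{Z}$, and the (logarithmic Weil) height is $h(\alpha)=\log(M(\alpha))/d$. *)

theory Defs
  imports
    "HOL-Algebra.Algebraic_Closure_Type"
    "HOL-Algebra.Generated_Fields"
    "HOL-Analysis.Analysis"
begin

text \<open>Algebraic numbers are taken inside \<^typ>\<open>complex\<close>. Irreducibility in
  \<open>\<int>[X]\<close> forces the polynomial to be primitive, so the sign of the leading coefficient is the
  only remaining ambiguity. The value is only meaningful for algebraic arguments.\<close>

definition int_minpoly :: "complex \<Rightarrow> int poly" where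
  "int_minpoly x =
     (THE p. Factorial_Ring.irreducible p \<and> Polynomial.lead_coeff p > 0 \<and>
             poly (map_poly of_int p) x = 0)"

definition alg_degree :: "complex \<Rightarrow> nat" where
  "alg_degree x = Polynomial.degree (int_minpoly x)"

text \<open>An irreducible integer polynomial is separable, so this set has exactly
  \<open>alg_degree x\<close> elements and products over it need no multiplicities.\<close>

definition conjugates :: "complex \<Rightarrow> complex set" where
  "conjugates x = {z. poly (map_poly of_int (int_minpoly x)) z = 0}"

definition mahler_measure :: "complex \<Rightarrow> real" where
  "mahler_measure x =
     \<bar>real_of_int (Polynomial.lead_coeff (int_minpoly x))\<bar> * (\<Prod>z\<in>conjugates x. max 1 (cmod z))"

definition weil_height :: "complex \<Rightarrow> real" where
  "weil_height x = ln (mahler_measure x) / real (alg_degree x)"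

abbreviation complex_ring :: "complex ring" where
  "complex_ring \<equiv> ring_of_type_algebra"

text \<open>The field \<open>\<rat>(S)\<close>: every subfield of \<^typ>\<open>complex\<close> contains the rationals, so the
  subfield generated by \<open>S\<close> is the extension of the rationals by \<open>S\<close>.\<close>

definition rat_adjoin :: "complex set \<Rightarrow> complex set" where
  "rat_adjoin S = generate_field complex_ring S"

text \<open>Extensionality makes embeddings that agree on \<open>K\<close> equal as HOL functions.\<close>

definition complex_embeddings :: "complex set \<Rightarrow> (complex \<Rightarrow> complex) set" where
  "complex_embeddings K = ring_hom (complex_ring\<lparr>carrier := K\<rparr>) complex_ring \<inter> extensional K"

text \<open>The norm of \<open>K\<close> over the rationals; meaningful when \<open>K\<close> is a number field, which has only finitely
  many embeddings.\<close>

definition field_norm :: "complex set \<Rightarrow> complex \<Rightarrow> complex" where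
  "field_norm K x = (\<Prod>\<sigma>\<in>complex_embeddings K. \<sigma> x)"

definition algebraic_unit :: "complex \<Rightarrow> bool" where
  "algebraic_unit x \<longleftrightarrow> algebraic_int x \<and> (\<exists>y. algebraic_int y \<and> x * y = 1)"

end

theory Submission
  imports Defs
begin

text \<open>Write \<open>S(x)\<close> for the sum of \<open>ln \<bar>z\<bar>\<close> over the conjugates \<open>z\<close> of \<open>x\<close>. If the minimal polynomial
  of \<open>\<alpha>\<close> has leading coefficient \<open>a\<close> and constant coefficient \<open>c\<close>, then \<open>S(\<alpha>) = ln \<bar>c / a\<bar>\<close>, while
  \<open>M(\<alpha>) \<ge> \<bar>a\<bar>\<close> and \<open>M(\<alpha>) \<ge> \<bar>c\<bar>\<close>; as both are at least 1, \<open>\<bar>S(\<alpha>)\<bar> \<le> ln M(\<alpha>)\<close>. Since each \<open>\<beta>\<^sub>i\<close> lies in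
  \<open>\<rat>(\<alpha>)\<close>, every embedding of \<open>\<rat>(\<alpha>)\<close> writes a conjugate of \<open>\<alpha>\<close> as the same power product of
  conjugates of \<open>\<beta>\<close>, and each conjugate of \<open>\<beta>\<close> is the image of \<open>\<beta>\<^sub>i\<close> under equally many embeddings.
  With \<open>d\<close> the degree of \<open>\<alpha>\<close> this gives \<open>n S(\<alpha>) = d (\<Sum>i. a\<^sub>i) S(\<beta>)\<close>, where \<open>S(\<beta>) = ln \<bar>N(\<beta>)\<bar>\<close>.
  For a nonunit \<open>\<beta>\<close> the norm is an integer of absolute value at least 2.\<close>

subsection \<open>Minimal polynomials and conjugates\<close>

abbreviation ipoly :: "int poly \<Rightarrow> complex poly" where
  "ipoly p \<equiv> map_poly of_int p"

lemma coeff_ipoly [simp]: "Polynomial.coeff (ipoly p) i = of_int (Polynomial.coeff p i)"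
  by (simp add: coeff_map_poly)

lemma ipoly_1 [simp]: "ipoly 1 = 1"
  by (simp add: map_poly_1)

lemma ipoly_pCons [simp]: "ipoly (pCons a p) = pCons (of_int a) (ipoly p)"
  by (rule map_poly_pCons) simp

lemma ipoly_add [simp]: "ipoly (p + q) = ipoly p + ipoly q"
  by (rule poly_eqI) simp

lemma ipoly_diff [simp]: "ipoly (p - q) = ipoly p - ipoly q"
  by (rule poly_eqI) simp

lemma ipoly_minus [simp]: "ipoly (- p) = - ipoly p"
  by (rule poly_eqI) simp

lemma ipoly_smult [simp]: "ipoly (smult c p) = smult (of_int c) (ipoly p)"
  by (rule poly_eqI) simp

lemma ipoly_mult [simp]: "ipoly (p * q) = ipoly p * ipoly q"
  by (rule poly_eqI) (simp add: coeff_mult)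

lemma ipoly_power [simp]: "ipoly (p ^ n) = ipoly p ^ n"
  by (induction n) simp_all

lemma ipoly_sum [simp]: "ipoly (sum f A) = (\<Sum>a\<in>A. ipoly (f a))"
  by (induction A rule: infinite_finite_induct) simp_all

lemma ipoly_monom [simp]: "ipoly (Polynomial.monom c n) = Polynomial.monom (of_int c) n"
  by (simp add: map_poly_monom)

lemma ipoly_pcompose [simp]: "ipoly (pcompose p q) = pcompose (ipoly p) (ipoly q)"
  by (induction p) (simp_all add: pcompose_pCons)

lemma ipoly_pderiv [simp]: "ipoly (pderiv p) = pderiv (ipoly p)"
  by (rule poly_eqI) (simp add: coeff_pderiv)

lemma degree_ipoly [simp]: "Polynomial.degree (ipoly p) = Polynomial.degree p"
  by (simp add: degree_map_poly)

lemma ipoly_eq_0_iff [simp]: "ipoly p = 0 \<longleftrightarrow> p = 0"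
  by (simp add: poly_eq_iff)

text \<open>A form of Gauss's lemma that stays inside Z[X]. A nonzero integer polynomial
  \<open>g\<close> of least degree vanishing at \<open>x\<close> divides some nonzero integer
  multiple of every polynomial vanishing at \<open>x\<close>. Primality of \<open>p\<close> first
  gives \<open>p dvd g\<close> and then removes the integer multiplier of \<open>q\<close>.\<close>

lemma irreducible_imp_dvd_of_common_root:
  fixes p q :: "int poly" and x :: complex
  assumes irr: "Factorial_Ring.irreducible p"
    and p: "poly (ipoly p) x = 0" and q: "poly (ipoly q) x = 0"
  shows "p dvd q"
proof -
  have p0: "p \<noteq> 0"
    using irr by (auto simp: irreducible_def)
  define S where "S = (\<lambda>g. g \<noteq> 0 \<and> poly (ipoly g) x = 0)"
  define g where "g = arg_min Polynomial.degree S"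
  have "S p" using p p0 by (simp add: S_def)
  hence "S g" and g_min: "\<And>h. S h \<Longrightarrow> Polynomial.degree g \<le> Polynomial.degree h"
    unfolding g_def by (auto intro: arg_min_natI arg_min_nat_le)
  hence g: "g \<noteq> 0" "poly (ipoly g) x = 0" by (auto simp: S_def)
  \<comment> \<open>Pseudo-division avoids fractions. The remainder also vanishes at
    \<open>x\<close>, so minimality of \<open>g\<close> forces it to be zero.\<close>
  have g_dvd: "\<exists>a s. a \<noteq> 0 \<and> smult a h = g * s" if h: "poly (ipoly h) x = 0" for h
  proof -
    obtain a s where as: "a \<noteq> 0" "smult a h = g * s + pseudo_mod h g"
      using pseudo_mod(1)[OF g(1)] by blast
    have "poly (ipoly (smult a h)) x = poly (ipoly (g * s + pseudo_mod h g)) x"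
      by (simp only: as)
    hence "poly (ipoly (pseudo_mod h g)) x = 0"
      using h g by simp
    hence "pseudo_mod h g = 0"
      using g_min[of "pseudo_mod h g"] pseudo_mod(2)[OF g(1), of h] unfolding S_def by linarith
    thus ?thesis using as by auto
  qed
  \<comment> \<open>A nonzero constant has no root. This positivity rules out both that
    \<open>p\<close> divides \<open>s\<close> and that \<open>p\<close> divides a nonzero
    constant.\<close>
  have deg_g: "Polynomial.degree g > 0"
  proof (rule ccontr)
    assume "\<not> Polynomial.degree g > 0"
    then obtain c where "g = [:c:]" by (auto elim: degree_eq_zeroE)
    thus False using g by simp
  qed
  have prime: "prime_elem p"
    using irr by (rule irreducible_imp_prime_elem)
  have not_const: "\<not> p dvd [:c:]" if "c \<noteq> 0" for c
  proof
    assume "p dvd [:c:]"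
    hence "Polynomial.degree p \<le> 0"
      using that dvd_imp_degree_le[of p "[:c:]"] by simp
    thus False using deg_g g_min[OF \<open>S p\<close>] by simp
  qed
  obtain a s where as: "a \<noteq> 0" "smult a p = g * s"
    using g_dvd[OF p] by blast
  have "p dvd g * s"
    unfolding as(2)[symmetric] by (rule dvd_smult) simp
  moreover have "\<not> p dvd s"
  proof
    assume ps: "p dvd s"
    have s0: "s \<noteq> 0" using as p0 by auto
    have "Polynomial.degree p = Polynomial.degree g + Polynomial.degree s"
      using arg_cong[OF as(2), of Polynomial.degree] as(1) g(1) s0 by (simp add: degree_mult_eq)
    thus False using dvd_imp_degree_le[OF ps s0] deg_g by simp
  qed
  ultimately have "p dvd g"
    using prime by (auto simp: prime_elem_dvd_mult_iff)
  obtain b t where bt: "b \<noteq> 0" "smult b q = g * t"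
    using g_dvd[OF q] by blast
  hence "p dvd [:b:] * q"
    using \<open>p dvd g\<close> by simp
  thus ?thesis
    using prime_elem_dvd_mult_iff[OF prime] not_const[OF bt(1)] by blast
qed

text \<open>Mutual divisibility leaves only a unit of Z[X], that is 1 or -1, and the positive
  leading coefficients fix the sign.\<close>

lemma irreducible_eq_of_common_root:
  fixes p q :: "int poly" and x :: complex
  assumes "Factorial_Ring.irreducible p" "Factorial_Ring.irreducible q"
    and "poly (ipoly p) x = 0" "poly (ipoly q) x = 0"
    and "Polynomial.lead_coeff p > 0" "Polynomial.lead_coeff q > 0"
  shows "p = q"
proof -
  have "p dvd q" "q dvd p"
    using assms irreducible_imp_dvd_of_common_root by blast+
  obtain r where r: "q = p * r"
    using \<open>p dvd q\<close> by (elim dvdE)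
  have "p * r dvd p * 1"
    using \<open>q dvd p\<close> r by simp
  hence "is_unit r"
    using assms(1) unfolding dvd_mult_cancel_left by (auto simp: irreducible_def)
  then obtain c where c: "r = [:c:]" "is_unit c"
    by (auto simp: is_unit_poly_iff)
  hence "c = 1 \<or> c = -1" by (auto simp: zdvd1_eq)
  thus ?thesis
    using assms(5,6) r c by auto
qed

text \<open>Induction along a prime factorisation of an annihilating polynomial: one of the prime
  factors vanishes at \<open>x\<close>. Negating it if necessary makes the leading coefficient
  positive.\<close>

lemma ex_irreducible_int_poly:
  assumes "algebraic (x :: complex)"
  shows "\<exists>p. Factorial_Ring.irreducible p \<and> Polynomial.lead_coeff p > 0 \<and> poly (ipoly p) x = 0"
proof -
  obtain p where p: "p \<noteq> 0" "poly (ipoly p) x = 0"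
    using assms by (auto elim: algebraicE')
  have "\<exists>q. Factorial_Ring.irreducible q \<and> poly (ipoly q) x = 0"
    using p
  proof (induction p rule: prime_divisors_induct)
    case (unit p)
    then obtain c where "p = [:c:]" "c \<noteq> 0" by (auto simp: is_unit_poly_iff)
    thus ?case using unit by auto
  next
    case (factor p q)
    hence "Factorial_Ring.irreducible p" by (auto dest: prime_elem_imp_irreducible)
    thus ?case using factor by auto
  qed auto
  then obtain q where q: "Factorial_Ring.irreducible q" "poly (ipoly q) x = 0" by blast
  have "q \<noteq> 0" using q(1) by (auto simp: irreducible_def)
  show ?thesis
  proof (cases "Polynomial.lead_coeff q > 0")
    case False
    hence "Polynomial.lead_coeff (-q) > 0"
      using \<open>q \<noteq> 0\<close> by (simp add: less_le)
    moreover have "Factorial_Ring.irreducible (-q)"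
      using q(1) irreducible_mult_unit_left[of "-1" q] by simp
    ultimately show ?thesis using q(2) by (intro exI[of _ "-q"]) simp
  qed (use q in auto)
qed

text \<open>Existence and uniqueness make the definite description in \<open>int_minpoly\<close>
  denote.\<close>

lemma
  assumes "algebraic (x :: complex)"
  shows irreducible_int_minpoly: "Factorial_Ring.irreducible (int_minpoly x)"
    and lead_coeff_int_minpoly: "Polynomial.lead_coeff (int_minpoly x) > 0"
    and poly_int_minpoly: "poly (ipoly (int_minpoly x)) x = 0"
proof -
  have "\<exists>!p. Factorial_Ring.irreducible p \<and> Polynomial.lead_coeff p > 0 \<and> poly (ipoly p) x = 0"
    using ex_irreducible_int_poly[OF assms] by (auto intro: irreducible_eq_of_common_root)
  from theI'[OF this] show "Factorial_Ring.irreducible (int_minpoly x)"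
    "Polynomial.lead_coeff (int_minpoly x) > 0" "poly (ipoly (int_minpoly x)) x = 0"
    by (simp_all add: int_minpoly_def)
qed

section \<open>Conjugates and separability\<close>

lemma self_in_conjugates: "algebraic x \<Longrightarrow> x \<in> conjugates x"
  by (simp add: conjugates_def poly_int_minpoly)

lemma int_minpoly_neq_0: "algebraic x \<Longrightarrow> int_minpoly x \<noteq> 0"
  using lead_coeff_int_minpoly by fastforce

lemma int_minpoly_dvd_iff:
  assumes "algebraic x" "z \<in> conjugates x"
  shows "int_minpoly x dvd q \<longleftrightarrow> poly (ipoly q) z = 0"
  using assms irreducible_imp_dvd_of_common_root[OF irreducible_int_minpoly]
  by (auto simp: conjugates_def elim!: dvdE)

text \<open>Both sides amount to divisibility of \<open>q\<close> by \<open>int_minpoly x\<close>.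
  This is what later makes the map from f(x) to f(z) well defined.\<close>

lemma poly_conjugate_eq_0_iff:
  assumes "algebraic x" "z \<in> conjugates x"
  shows "poly (ipoly q) z = 0 \<longleftrightarrow> poly (ipoly q) x = 0"
  using assms int_minpoly_dvd_iff self_in_conjugates by blast

lemma algebraic_conjugate:
  assumes "algebraic x" "z \<in> conjugates x"
  shows "algebraic z"
  using assms int_minpoly_neq_0[of x]
  by (intro algebraicI[of "ipoly (int_minpoly x)"]) (auto simp: conjugates_def)

lemma int_minpoly_conjugate:
  assumes "algebraic x" "z \<in> conjugates x"
  shows "int_minpoly z = int_minpoly x"
  using assms algebraic_conjugate[OF assms]
  by (intro irreducible_eq_of_common_root[of _ _ z])
    (auto simp: irreducible_int_minpoly lead_coeff_int_minpoly poly_int_minpoly conjugates_def)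

lemma degree_int_minpoly_pos:
  assumes "algebraic x"
  shows "Polynomial.degree (int_minpoly x) > 0"
proof (rule ccontr)
  assume "\<not> ?thesis"
  then obtain c where "int_minpoly x = [:c:]" by (auto elim: degree_eq_zeroE)
  thus False using assms poly_int_minpoly[of x] int_minpoly_neq_0[of x] by simp
qed

text \<open>A multiple root would be shared with the derivative, so the minimal polynomial would
  divide its own derivative, which is nonzero and of smaller degree.\<close>

lemma rsquarefree_int_minpoly:
  assumes "algebraic x"
  shows "rsquarefree (ipoly (int_minpoly x))"
  unfolding rsquarefree_roots
proof (intro allI notI)
  fix z assume z: "poly (ipoly (int_minpoly x)) z = 0 \<and> poly (pderiv (ipoly (int_minpoly x))) z = 0"
  hence "int_minpoly x dvd pderiv (int_minpoly x)"
    using assms by (subst int_minpoly_dvd_iff[of _ z]) (auto simp: conjugates_def)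
  moreover have "pderiv (int_minpoly x) \<noteq> 0"
    using degree_int_minpoly_pos[OF assms] by (simp add: pderiv_eq_0_iff)
  ultimately show False
    using degree_int_minpoly_pos[OF assms] dvd_imp_degree_le degree_pderiv[of "int_minpoly x"]
    by fastforce
qed

lemma finite_conjugates: "algebraic x \<Longrightarrow> finite (conjugates x)"
  unfolding conjugates_def by (rule poly_roots_finite) (simp add: int_minpoly_neq_0)

lemma int_minpoly_decompose:
  assumes "algebraic x"
  shows "ipoly (int_minpoly x) =
    smult (of_int (Polynomial.lead_coeff (int_minpoly x))) (\<Prod>z\<in>conjugates x. [:-z, 1:])"
  using complex_poly_decompose_rsquarefree[OF rsquarefree_int_minpoly[OF assms]]
  by (simp add: conjugates_def)

lemma card_conjugates:
  assumes "algebraic x"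
  shows "card (conjugates x) = alg_degree x"
proof -
  have "alg_degree x = Polynomial.degree (ipoly (int_minpoly x))"
    by (simp add: alg_degree_def)
  also have "\<dots> = Polynomial.degree (\<Prod>z\<in>conjugates x. [:-z, 1:])"
    using lead_coeff_int_minpoly[OF assms] by (subst int_minpoly_decompose[OF assms]) auto
  also have "\<dots> = card (conjugates x)"
    by (simp add: degree_prod_sum_eq)
  finally show ?thesis by simp
qed

text \<open>Vieta's formula: evaluate the factorisation over the conjugates at 0.\<close>

lemma cmod_coeff_0_int_minpoly:
  assumes "algebraic x"
  shows "\<bar>real_of_int (Polynomial.coeff (int_minpoly x) 0)\<bar> =
    \<bar>real_of_int (Polynomial.lead_coeff (int_minpoly x))\<bar> * (\<Prod>z\<in>conjugates x. cmod z)"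
proof -
  have "of_int (Polynomial.coeff (int_minpoly x) 0) = poly (ipoly (int_minpoly x)) 0"
    by (simp add: poly_0_coeff_0)
  also have "\<dots> = of_int (Polynomial.lead_coeff (int_minpoly x)) * (\<Prod>z\<in>conjugates x. - z)"
    by (subst int_minpoly_decompose[OF assms]) (simp add: poly_prod)
  finally have "cmod (of_int (Polynomial.coeff (int_minpoly x) 0)) =
    cmod (of_int (Polynomial.lead_coeff (int_minpoly x)) * (\<Prod>z\<in>conjugates x. - z))" by simp
  thus ?thesis by (simp add: norm_mult prod_norm[symmetric])
qed

lemma conjugate_neq_0:
  assumes "algebraic x" "x \<noteq> 0" "z \<in> conjugates x"
  shows "z \<noteq> 0"
  \<comment> \<open>The polynomial \<open>[:0, 1:]\<close> is X: it vanishes at \<open>z\<close>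
    only if it vanishes at \<open>x\<close>.\<close>
  using poly_conjugate_eq_0_iff[OF assms(1,3), of "[:0, 1:]"] assms(2) by simp

lemma coeff_0_int_minpoly_neq_0:
  assumes "algebraic x" "x \<noteq> 0"
  shows "Polynomial.coeff (int_minpoly x) 0 \<noteq> 0"
proof
  assume "Polynomial.coeff (int_minpoly x) 0 = 0"
  hence "poly (ipoly (int_minpoly x)) 0 = 0" by (simp add: poly_0_coeff_0)
  thus False
    using conjugate_neq_0[OF assms, of 0] by (simp add: conjugates_def)
qed

subsection \<open>Rationality of products over conjugates\<close>

lemma poly_eq_prod_proots:
  fixes p :: "complex poly"
  shows "poly p z = Polynomial.lead_coeff p * (\<Prod>a\<in>#proots p. z - a)"
proof -
  have *: "poly (\<Prod>a\<in>#A. [:- a, 1:]) z = (\<Prod>a\<in>#A. z - a)" for A :: "complex multiset"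
    by (induction A) (simp_all add: algebra_simps)
  show ?thesis
    by (subst complex_poly_decompose_multiset[symmetric]) (simp add: *)
qed

lemma prod_mset_uminus_diff:
  "(\<Prod>a\<in>#A. a - b) = (-1) ^ size A * (\<Prod>a\<in>#A. b - (a :: complex))"
  by (induction A) (simp_all add: algebra_simps)

lemma prod_mset_cmult:
  "(\<Prod>a\<in>#A. c * f a) = c ^ size A * (\<Prod>a\<in>#A. f a :: complex)"
  by (induction A) (simp_all add: algebra_simps)

text \<open>The product is, up to powers of the leading coefficients, the resultant of \<open>p\<close> and \<open>f\<close>:
  exchanging the roles of the two polynomials and reducing \<open>p\<close> modulo \<open>f\<close> lowers the degree.\<close>

lemma prod_proots_rational:
  fixes p f :: "int poly"
  assumes "p \<noteq> 0"
  shows "(\<Prod>a\<in>#proots (ipoly p). poly (ipoly f) a) \<in> \<rat>"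
  using assms
proof (induction "Polynomial.degree f" arbitrary: p f rule: less_induct)
  case less
  show ?case
  proof (cases "Polynomial.degree f = 0")
    case True
    then obtain k where "f = [:k:]" by (auto elim: degree_eq_zeroE)
    hence "(\<Prod>a\<in>#proots (ipoly p). poly (ipoly f) a) = (\<Prod>a\<in>#proots (ipoly p). of_int k)"
      by (intro arg_cong[of _ _ prod_mset] image_mset_cong) simp
    thus ?thesis by simp
  next
    case False
    hence f: "f \<noteq> 0" by auto
    define A B where "A = proots (ipoly p)" and "B = proots (ipoly f)"
    define cp cf :: complex
      where "cp = of_int (Polynomial.lead_coeff p)" and "cf = of_int (Polynomial.lead_coeff f)"
    have cp: "cp \<noteq> 0" using less.prems by (simp add: cp_def)
    define r where "r = pseudo_mod p f"
    obtain k s where k: "k \<noteq> 0" "smult k p = f * s + r"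
      using pseudo_mod(1)[OF f] unfolding r_def by blast
    have r_deg: "Polynomial.degree r < Polynomial.degree f"
      using pseudo_mod(2)[OF f, of p] False unfolding r_def by auto
    \<comment> \<open>At a root of \<open>f\<close> the pseudo-division identity reads k p = r, so
      \<open>p\<close> may be traded for a remainder of degree below that of
      \<open>f\<close>.\<close>
    have p_eq: "poly (ipoly p) b = poly (ipoly r) b / of_int k" if "b \<in># B" for b
    proof -
      have "poly (ipoly f) b = 0" using that f by (simp add: B_def)
      moreover have "poly (ipoly (smult k p)) b = poly (ipoly (f * s + r)) b"
        by (simp only: k(2))
      ultimately show ?thesis using k(1) by (simp add: field_simps)
    qed
    have "(\<Prod>a\<in>#A. poly (ipoly f) a) = (\<Prod>a\<in>#A. cf * (\<Prod>b\<in>#B. a - b))"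
      by (subst poly_eq_prod_proots) (simp add: cf_def B_def)
    also have "\<dots> = cf ^ size A * (\<Prod>b\<in>#B. \<Prod>a\<in>#A. a - b)"
      by (subst prod_mset_cmult, subst prod_mset.swap) simp
    \<comment> \<open>The sign comes from reversing the differences, \<open>cp\<close> from
      factoring \<open>p\<close> at \<open>b\<close>, and \<open>k\<close> from the
      pseudo-division.\<close>
    also have "(\<Prod>b\<in>#B. \<Prod>a\<in>#A. a - b) =
        (\<Prod>b\<in>#B. (-1) ^ size A / (cp * of_int k) * poly (ipoly r) b)"
    proof (intro arg_cong[of _ _ prod_mset] image_mset_cong)
      fix b assume b: "b \<in># B"
      have "(\<Prod>a\<in>#A. a - b) = (-1) ^ size A / cp * poly (ipoly p) b"
        using cp poly_eq_prod_proots[of "ipoly p" b]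
        by (simp add: prod_mset_uminus_diff cp_def A_def)
      thus "(\<Prod>a\<in>#A. a - b) = (-1) ^ size A / (cp * of_int k) * poly (ipoly r) b"
        by (simp add: p_eq[OF b])
    qed
    also have "\<dots> = ((-1) ^ size A / (cp * of_int k)) ^ size B * (\<Prod>b\<in>#B. poly (ipoly r) b)"
      by (rule prod_mset_cmult)
    also have "cf ^ size A * \<dots> \<in> \<rat>"
      using less.hyps[OF r_deg f] unfolding B_def[symmetric]
      by (intro Rats_mult Rats_power Rats_divide) (auto simp: cf_def cp_def)
    finally show ?thesis by (simp add: A_def)
  qed
qed

text \<open>By separability every conjugate is a root of multiplicity one, so the multiset of roots
  can be replaced by the set \<open>conjugates x\<close>.\<close>

lemma prod_conjugates_rational:
  assumes "algebraic x"
  shows "(\<Prod>z\<in>conjugates x. poly (ipoly f) z) \<in> \<rat>"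
proof -
  have "(\<Prod>a\<in>#proots (ipoly (int_minpoly x)). poly (ipoly f) a) =
      (\<Prod>z\<in>conjugates x. poly (ipoly f) z ^ Polynomial.order z (ipoly (int_minpoly x)))"
    using int_minpoly_neq_0[OF assms]
    by (subst image_prod_mset_multiplicity) (simp add: conjugates_def)
  also have "\<dots> = (\<Prod>z\<in>conjugates x. poly (ipoly f) z)"
    using rsquarefree_root_order[OF rsquarefree_int_minpoly[OF assms]] int_minpoly_neq_0[OF assms]
    by (intro prod.cong) (auto simp: conjugates_def)
  finally show ?thesis
    using prod_proots_rational[OF int_minpoly_neq_0[OF assms], of f] by simp
qed

text \<open>As in Newton interpolation, subtract the value at \<open>m0\<close> and divide by X -
  m0: the quotient has lower degree. Its values are visibly rational only from \<open>m0 + 1\<close>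
  on, hence the threshold in the hypothesis.\<close>

lemma coeff_rational_of_values:
  fixes G :: "complex poly"
  assumes "\<And>m. m \<ge> m0 \<Longrightarrow> poly G (of_nat m) \<in> \<rat>"
  shows "Polynomial.coeff G i \<in> \<rat>"
  using assms
proof (induction "Polynomial.degree G" arbitrary: G m0 i rule: less_induct)
  case less
  show ?case
  proof (cases "Polynomial.degree G = 0")
    case True
    then obtain c where "G = [:c:]" by (auto elim: degree_eq_zeroE)
    thus ?thesis using less.prems[of m0] by (cases i) auto
  next
    case False
    define r where "r = poly G (of_nat m0)"
    have "poly (G - [:r:]) (of_nat m0) = 0" by (simp add: r_def)
    then obtain H where H: "G - [:r:] = [:- of_nat m0, 1:] * H"
      unfolding poly_eq_0_iff_dvd dvd_def by blast
    hence G: "G = [:- of_nat m0, 1:] * H + [:r:]" by (simp add: algebra_simps)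
    have r: "r \<in> \<rat>" using less.prems[of m0] by (simp add: r_def)
    have H0: "H \<noteq> 0" using G False by auto
    have "Polynomial.degree (G - [:r:]) = Suc (Polynomial.degree H)"
      unfolding H using H0 by (subst degree_mult_eq) auto
    hence "Polynomial.degree H < Polynomial.degree G"
      using degree_diff_le_max[of G "[:r:]"] by simp
    moreover have "poly H (of_nat m) \<in> \<rat>" if "m \<ge> Suc m0" for m
    proof -
      have ne: "(of_nat m - of_nat m0 :: complex) \<noteq> 0" using that by simp
      have "poly G (of_nat m) = (of_nat m - of_nat m0) * poly H (of_nat m) + r"
        by (subst G) (simp add: algebra_simps)
      hence "poly H (of_nat m) = (poly G (of_nat m) - r) / (of_nat m - of_nat m0)"
        using ne by (simp add: field_simps)
      thus ?thesis using r less.prems[of m] that by (auto intro!: Rats_divide Rats_diff)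
    qed
    ultimately have IH: "Polynomial.coeff H j \<in> \<rat>" for j
      using less.hyps by blast
    show ?thesis
      by (subst G, cases i) (auto intro!: Rats_add Rats_diff Rats_mult simp: IH r)
  qed
qed

lemma clear_denominators:
  fixes G :: "complex poly"
  assumes "\<And>i. Polynomial.coeff G i \<in> \<rat>"
  shows "\<exists>d q. d \<noteq> 0 \<and> smult (of_int d) G = ipoly q"
  using assms
proof (induction G)
  case 0
  show ?case by (intro exI[of _ 1] exI[of _ 0]) simp
next
  case (pCons a G)
  have "a \<in> \<rat>" using pCons.prems[of 0] by simp
  then obtain m n where mn: "n \<noteq> 0" "a = of_int m / of_int n"
    using Rats_cases'[of a] by (metis less_irrefl)
  have "Polynomial.coeff G i \<in> \<rat>" for i
    using pCons.prems[of "Suc i"] by simp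
  then obtain d q where dq: "d \<noteq> 0" "smult (of_int d) G = ipoly q"
    using pCons.IH by blast
  have "smult (of_int (n * d)) (pCons a G) = pCons (of_int (m * d)) (smult (of_int n) (smult (of_int d) G))"
    using mn by simp
  also have "\<dots> = ipoly (pCons (m * d) (smult n q))"
    by (simp add: dq)
  finally show ?case
    using mn(1) dq(1) by (intro exI[of _ "n * d"] exI[of _ "pCons (m * d) (smult n q)"] conjI) simp_all
qed

text \<open>In the uses, \<open>g z\<close> and \<open>F m\<close> are the two specialisations of
  one integer polynomial in two variables. The product over the conjugates takes rational values at
  the naturals, so its coefficients are rational; this takes the place of the theorem on symmetric
  polynomials.\<close>

lemma conjugates_prod_int_poly:
  assumes "algebraic x"
    and "\<And>m z. z \<in> conjugates x \<Longrightarrow> poly (g z) (of_nat m) = poly (ipoly (F m)) z"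
  shows "\<exists>d q. d \<noteq> 0 \<and> smult (of_int d) (\<Prod>z\<in>conjugates x. g z) = ipoly q"
proof (intro clear_denominators coeff_rational_of_values[where ?m0.0 = 0])
  fix m
  have "poly (\<Prod>z\<in>conjugates x. g z) (of_nat m) = (\<Prod>z\<in>conjugates x. poly (ipoly (F m)) z)"
    using assms(2) by (simp add: poly_prod)
  thus "poly (\<Prod>z\<in>conjugates x. g z) (of_nat m) \<in> \<rat>"
    using prod_conjugates_rational[OF assms(1)] by simp
qed

text \<open>The factor at \<open>x\<close> itself vanishes at \<open>y\<close>, and a nonzero
  integer multiple of the nonzero product is an integer polynomial.\<close>

lemma algebraic_if_conjugates_prod_root:
  assumes x: "algebraic x"
    and g: "\<And>m z. z \<in> conjugates x \<Longrightarrow> poly (g z) (of_nat m) = poly (ipoly (F m)) z"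
    and "\<And>z. z \<in> conjugates x \<Longrightarrow> g z \<noteq> 0" and root: "poly (g x) y = 0"
  shows "algebraic y"
proof -
  obtain d q where dq: "d \<noteq> 0" "smult (of_int d) (\<Prod>z\<in>conjugates x. g z) = ipoly q"
    using conjugates_prod_int_poly[OF x g] by blast
  have "(\<Prod>z\<in>conjugates x. g z) \<noteq> 0"
    using assms(3) finite_conjugates[OF x] by simp
  hence "q \<noteq> 0"
    using dq by (metis map_poly_0 of_int_eq_0_iff smult_eq_0_iff)
  have "poly (\<Prod>z\<in>conjugates x. g z) y = 0"
    using root self_in_conjugates[OF x] finite_conjugates[OF x] by (auto simp: poly_prod)
  hence "poly (ipoly q) y = 0"
    by (simp add: dq(2)[symmetric])
  thus ?thesis
    using \<open>q \<noteq> 0\<close> by (intro algebraicI[of "ipoly q"]) auto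
qed

section \<open>Closure properties of algebraic numbers\<close>

lemma algebraic_poly:
  assumes "algebraic x"
  shows "algebraic (poly (ipoly f) x)"
  by (rule algebraic_if_conjugates_prod_root[OF assms,
        where g = "\<lambda>z. [:- poly (ipoly f) z, 1:]" and F = "\<lambda>m. [:int m:] - f"]) auto

text \<open>With \<open>q\<close> the minimal polynomial of \<open>y\<close>, of degree
  \<open>n\<close>, the factor at \<open>z\<close> is z^n q(X / z), expanded so as to make sense for
  z = 0 too. At z = x it has the root x y.\<close>

lemma algebraic_times:
  assumes "algebraic x" "algebraic (y :: complex)"
  shows "algebraic (x * y)"
proof -
  define q n where "q = int_minpoly y" and "n = Polynomial.degree q"
  have q: "q \<noteq> 0" "poly (ipoly q) y = 0"
    using assms(2) by (auto simp: q_def int_minpoly_neq_0 poly_int_minpoly)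
  show ?thesis
  proof (rule algebraic_if_conjugates_prod_root[OF assms(1),
      where g = "\<lambda>z. \<Sum>i\<le>n. Polynomial.monom (of_int (Polynomial.coeff q i) * z ^ (n - i)) i"
        and F = "\<lambda>m. \<Sum>i\<le>n. Polynomial.monom (Polynomial.coeff q i * int m ^ i) (n - i)"])
    fix z :: complex
    \<comment> \<open>The coefficient of X^n carries z^0, so it is the leading coefficient of
      \<open>q\<close> whatever \<open>z\<close> is.\<close>
    have "Polynomial.coeff (\<Sum>i\<le>n. Polynomial.monom (of_int (Polynomial.coeff q i) * z ^ (n - i)) i) n =
      of_int (Polynomial.coeff q n)"
      by (simp add: coeff_sum if_distrib[of "(*) _"] cong: if_cong)
    also have "\<dots> \<noteq> 0" using q by (simp add: n_def)
    finally show "(\<Sum>i\<le>n. Polynomial.monom (of_int (Polynomial.coeff q i) * z ^ (n - i)) i) \<noteq> 0"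
      by auto
  next
    have "poly (\<Sum>i\<le>n. Polynomial.monom (of_int (Polynomial.coeff q i) * x ^ (n - i)) i) (x * y) =
      (\<Sum>i\<le>n. x ^ n * (of_int (Polynomial.coeff q i) * y ^ i))"
      unfolding poly_sum
    proof (rule sum.cong)
      fix i assume "i \<in> {..n}"
      hence "x ^ n = x ^ (n - i) * x ^ i" by (simp flip: power_add)
      thus "poly (Polynomial.monom (of_int (Polynomial.coeff q i) * x ^ (n - i)) i) (x * y) =
          x ^ n * (of_int (Polynomial.coeff q i) * y ^ i)"
        by (simp add: poly_monom power_mult_distrib)
    qed simp
    also have "\<dots> = x ^ n * poly (ipoly q) y"
      by (simp add: poly_altdef n_def sum_distrib_left)
    finally show "poly (\<Sum>i\<le>n. Polynomial.monom (of_int (Polynomial.coeff q i) * x ^ (n - i)) i) (x * y) = 0"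
      using q by simp
  qed (auto simp: poly_sum poly_monom mult_ac)
qed

lemma algebraic_power: "algebraic (x :: complex) \<Longrightarrow> algebraic (x ^ n)"
  by (induction n) (auto intro: algebraic_times)

lemma algebraic_powi: "algebraic (x :: complex) \<Longrightarrow> algebraic (x powi k)"
  by (auto simp: power_int_def intro!: algebraic_power algebraic_inverse)

lemma algebraic_prod:
  "(\<And>i. i \<in> A \<Longrightarrow> algebraic (f i :: complex)) \<Longrightarrow> algebraic (\<Prod>i\<in>A. f i)"
  by (induction A rule: infinite_finite_induct) (auto intro: algebraic_times)

subsection \<open>Simple extensions of the rationals and their embeddings\<close>

lemma complex_ring_simps [simp]:
  "carrier complex_ring = UNIV" "x \<otimes>\<^bsub>complex_ring\<^esub> y = x * y" "\<one>\<^bsub>complex_ring\<^esub> = 1"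
  "\<zero>\<^bsub>complex_ring\<^esub> = 0" "x \<oplus>\<^bsub>complex_ring\<^esub> y = x + y"
  by (simp_all add: ring_of_type_algebra_def)

lemma complex_ring_a_inv [simp]: "\<ominus>\<^bsub>complex_ring\<^esub> x = - x"
proof -
  interpret field complex_ring ..
  show ?thesis by (rule sum_zero_eq_neg[symmetric]) simp_all
qed

lemma complex_ring_m_inv:
  assumes "x \<noteq> 0"
  shows "inv\<^bsub>complex_ring\<^esub> x = inverse x"
proof -
  interpret field complex_ring ..
  show ?thesis using assms by (intro comm_inv_char) simp_all
qed

lemma rat_adjoin_incl: "x \<in> S \<Longrightarrow> x \<in> rat_adjoin S"
  unfolding rat_adjoin_def by (rule generate_field.incl)

lemma one_in_rat_adjoin: "1 \<in> rat_adjoin S"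
  unfolding rat_adjoin_def using generate_field.one[of complex_ring S] by simp

lemma rat_adjoin_uminus: "x \<in> rat_adjoin S \<Longrightarrow> - x \<in> rat_adjoin S"
  unfolding rat_adjoin_def using generate_field.a_inv[of x complex_ring S] by simp

lemma rat_adjoin_add: "x \<in> rat_adjoin S \<Longrightarrow> y \<in> rat_adjoin S \<Longrightarrow> x + y \<in> rat_adjoin S"
  unfolding rat_adjoin_def by (drule (1) generate_field.eng_add) simp

lemma rat_adjoin_mult: "x \<in> rat_adjoin S \<Longrightarrow> y \<in> rat_adjoin S \<Longrightarrow> x * y \<in> rat_adjoin S"
  unfolding rat_adjoin_def by (drule (1) generate_field.eng_mult) simp

lemma zero_in_rat_adjoin: "0 \<in> rat_adjoin S"
  using rat_adjoin_add[OF one_in_rat_adjoin rat_adjoin_uminus[OF one_in_rat_adjoin], of S] by simp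

lemma rat_adjoin_inverse: "x \<in> rat_adjoin S \<Longrightarrow> inverse x \<in> rat_adjoin S"
  using zero_in_rat_adjoin[of S]
  by (cases "x = 0") (auto simp: rat_adjoin_def complex_ring_m_inv dest: generate_field.m_inv)

lemma rat_adjoin_power: "x \<in> rat_adjoin S \<Longrightarrow> x ^ n \<in> rat_adjoin S"
  by (induction n) (simp_all add: rat_adjoin_mult one_in_rat_adjoin)

lemma rat_adjoin_powi: "x \<in> rat_adjoin S \<Longrightarrow> x powi k \<in> rat_adjoin S"
  by (simp add: power_int_def rat_adjoin_power rat_adjoin_inverse)

lemma rat_adjoin_prod:
  "(\<And>i. i \<in> A \<Longrightarrow> f i \<in> rat_adjoin S) \<Longrightarrow> (\<Prod>i\<in>A. f i) \<in> rat_adjoin S"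
  by (induction A rule: infinite_finite_induct) (simp_all add: rat_adjoin_mult one_in_rat_adjoin)

lemma rat_adjoin_induct [consumes 1, case_names one incl uminus inverse add mult]:
  assumes "x \<in> rat_adjoin S"
    and "P 1" "\<And>x. x \<in> S \<Longrightarrow> P x" "\<And>x. x \<in> rat_adjoin S \<Longrightarrow> P x \<Longrightarrow> P (- x)"
    and "\<And>x. x \<in> rat_adjoin S \<Longrightarrow> P x \<Longrightarrow> x \<noteq> 0 \<Longrightarrow> P (inverse x)"
    and "\<And>x y. x \<in> rat_adjoin S \<Longrightarrow> y \<in> rat_adjoin S \<Longrightarrow> P x \<Longrightarrow> P y \<Longrightarrow> P (x + y)"
    and "\<And>x y. x \<in> rat_adjoin S \<Longrightarrow> y \<in> rat_adjoin S \<Longrightarrow> P x \<Longrightarrow> P y \<Longrightarrow> P (x * y)"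
  shows "P x"
  using assms(1) unfolding rat_adjoin_def
  by (induction rule: generate_field.induct)
    (use assms(2-) in \<open>simp_all add: rat_adjoin_def complex_ring_m_inv\<close>)

text \<open>Write the minimal polynomial as c + X q(X) and solve c + y q(y) = 0 for the inverse of
  \<open>y\<close>; \<open>c\<close> is nonzero because \<open>y\<close> is.\<close>

lemma algebraic_inverse_int_poly:
  assumes "algebraic (y :: complex)" "y \<noteq> 0"
  shows "\<exists>g c. c \<noteq> 0 \<and> inverse y = poly (ipoly g) y / of_int c"
proof -
  obtain c q where q: "int_minpoly y = pCons c q" by (cases "int_minpoly y")
  have eq: "of_int c + y * poly (ipoly q) y = 0"
    using poly_int_minpoly[OF assms(1)] by (simp add: q)
  have "c \<noteq> 0"
    using coeff_0_int_minpoly_neq_0[OF assms] by (simp add: q)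
  moreover have "inverse y = poly (ipoly (- q)) y / of_int c"
    using eq assms(2) \<open>c \<noteq> 0\<close> by (simp add: field_simps add_eq_0_iff)
  ultimately show ?thesis by blast
qed

text \<open>This is Q(x) = Q[x], with a common denominator \<open>c\<close>. Closure under inverses
  is where algebraicity of \<open>x\<close> enters.\<close>

lemma rat_adjoin_int_poly:
  assumes "algebraic x" "y \<in> rat_adjoin {x}"
  shows "\<exists>f c. c \<noteq> 0 \<and> y = poly (ipoly f) x / of_int c"
  using assms(2)
proof (induction rule: rat_adjoin_induct)
  case one
  show ?case by (rule exI[of _ 1], rule exI[of _ 1]) simp
next
  case (incl y)
  thus ?case by (intro exI[of _ "[:0, 1:]"] exI[of _ 1]) simp
next
  case (uminus y)
  then obtain f c where "c \<noteq> 0" "y = poly (ipoly f) x / of_int c" by blast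
  thus ?case by (intro exI[of _ "- f"] exI[of _ c]) simp
next
  case (inverse y)
  then obtain f c where fc: "c \<noteq> 0" "y = poly (ipoly f) x / of_int c" by blast
  with inverse have "poly (ipoly f) x \<noteq> 0" by auto
  \<comment> \<open>Since f(x) is itself algebraic, its inverse is a polynomial \<open>g\<close> in
    f(x) up to a denominator; composing \<open>g\<close> with \<open>f\<close> turns this into a
    polynomial in \<open>x\<close>.\<close>
  then obtain g e where ge: "e \<noteq> 0" "inverse (poly (ipoly f) x) = poly (ipoly g) (poly (ipoly f) x) / of_int e"
    using algebraic_inverse_int_poly[OF algebraic_poly[OF assms(1)]] by blast
  have "inverse y = of_int c * inverse (poly (ipoly f) x)"
    using fc by (simp add: divide_inverse mult.commute)
  also have "\<dots> = poly (ipoly (smult c (pcompose g f))) x / of_int e"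
    by (simp add: ge poly_pcompose)
  finally show ?case using ge(1) by blast
next
  case (add y y')
  then obtain f c where *: "c \<noteq> 0" "y = poly (ipoly f) x / of_int c" by blast
  obtain f' c' where **: "c' \<noteq> 0" "y' = poly (ipoly f') x / of_int c'" using add by blast
  have "y + y' = poly (ipoly (smult c' f + smult c f')) x / of_int (c * c')"
    using * ** by (simp add: field_simps)
  thus ?case
    using *(1) **(1) by (intro exI[of _ "smult c' f + smult c f'"] exI[of _ "c * c'"] conjI) simp_all
next
  case (mult y y')
  then obtain f c where *: "c \<noteq> 0" "y = poly (ipoly f) x / of_int c" by blast
  obtain f' c' where **: "c' \<noteq> 0" "y' = poly (ipoly f') x / of_int c'" using mult by blast
  have "y * y' = poly (ipoly (f * f')) x / of_int (c * c')"
    unfolding *(2) **(2) by simp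
  thus ?case
    using *(1) **(1) by (intro exI[of _ "f * f'"] exI[of _ "c * c'"] conjI) simp_all
qed

lemma algebraic_rat_adjoin:
  assumes "algebraic x" "y \<in> rat_adjoin {x}"
  shows "algebraic y"
proof -
  obtain f c where "c \<noteq> 0" "y = poly (ipoly f) x / of_int c"
    using rat_adjoin_int_poly[OF assms] by blast
  thus ?thesis
    using algebraic_times[OF algebraic_poly[OF assms(1), of f], of "inverse (of_int c)"]
    by (simp add: divide_inverse algebraic_inverse)
qed

text \<open>For a conjugate \<open>z\<close> of \<open>x\<close> this is the embedding of Q(x)
  sending \<open>x\<close> to \<open>z\<close>; the description denotes because the value does not
  depend on the representation f(x) / c. The restriction to Q(x) provides the extensionality in
  \<open>complex_embeddings\<close>.\<close>

definition conj_embedding :: "complex \<Rightarrow> complex \<Rightarrow> complex \<Rightarrow> complex" where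
  "conj_embedding x z = (\<lambda>y\<in>rat_adjoin {x}.
     THE w. \<exists>f c. c \<noteq> 0 \<and> y = poly (ipoly f) x / of_int c \<and> w = poly (ipoly f) z / of_int c)"

text \<open>Cross-multiplying turns the equality into the vanishing of an integer polynomial, which
  passes from \<open>x\<close> to its conjugates.\<close>

lemma poly_quotient_conjugate_cong:
  assumes x: "algebraic x" "z \<in> conjugates x" and nz: "c \<noteq> 0" "c' \<noteq> 0"
    and eq: "poly (ipoly f) x / of_int c = poly (ipoly f') x / of_int c'"
  shows "poly (ipoly f) z / of_int c = poly (ipoly f') z / of_int c'"
proof -
  have "poly (ipoly (smult c' f - smult c f')) x = 0"
    using eq nz by (simp add: field_simps)
  hence "poly (ipoly (smult c' f - smult c f')) z = 0"
    using poly_conjugate_eq_0_iff[OF x] by blast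
  thus ?thesis using nz by (simp add: field_simps)
qed

lemma conj_embedding_eq:
  assumes "algebraic x" "z \<in> conjugates x" "y \<in> rat_adjoin {x}"
    and "c \<noteq> 0" "y = poly (ipoly f) x / of_int c"
  shows "conj_embedding x z y = poly (ipoly f) z / of_int c"
proof -
  have "(THE w. \<exists>f c. c \<noteq> 0 \<and> y = poly (ipoly f) x / of_int c \<and> w = poly (ipoly f) z / of_int c) =
      poly (ipoly f) z / of_int c"
  proof (rule the_equality)
    show "\<exists>f' c'. c' \<noteq> 0 \<and> y = poly (ipoly f') x / of_int c' \<and>
        poly (ipoly f) z / of_int c = poly (ipoly f') z / of_int c'"
      using assms(4,5) by blast
  next
    fix w assume "\<exists>f' c'. c' \<noteq> 0 \<and> y = poly (ipoly f') x / of_int c' \<and> w = poly (ipoly f') z / of_int c'"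
    then obtain f' c' where f': "c' \<noteq> 0" "y = poly (ipoly f') x / of_int c'"
      and w: "w = poly (ipoly f') z / of_int c'" by blast
    show "w = poly (ipoly f) z / of_int c"
      unfolding w
      by (rule poly_quotient_conjugate_cong[OF assms(1,2) f'(1) assms(4)]) (simp only: f'(2)[symmetric] assms(5)[symmetric])
  qed
  thus ?thesis using assms(3) by (simp add: conj_embedding_def)
qed

context
  fixes x z
  assumes x: "algebraic x" and z: "z \<in> conjugates x"
begin

lemma conj_embedding_1: "conj_embedding x z 1 = 1"
  using conj_embedding_eq[OF x z one_in_rat_adjoin, of 1 1] by simp

lemma conj_embedding_self: "conj_embedding x z x = z"
  using conj_embedding_eq[OF x z rat_adjoin_incl, of x 1 "[:0, 1:]"] by simp

lemma conj_embedding_add: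
  assumes "y \<in> rat_adjoin {x}" "y' \<in> rat_adjoin {x}"
  shows "conj_embedding x z (y + y') = conj_embedding x z y + conj_embedding x z y'"
proof -
  obtain f c where *: "c \<noteq> 0" "y = poly (ipoly f) x / of_int c"
    using rat_adjoin_int_poly[OF x assms(1)] by blast
  obtain f' c' where **: "c' \<noteq> 0" "y' = poly (ipoly f') x / of_int c'"
    using rat_adjoin_int_poly[OF x assms(2)] by blast
  have "y + y' = poly (ipoly (smult c' f + smult c f')) x / of_int (c * c')"
    using *(1) **(1) by (simp add: *(2) **(2) add_frac_eq mult.commute)
  from conj_embedding_eq[OF x z rat_adjoin_add[OF assms] _ this]
  have "conj_embedding x z (y + y') = poly (ipoly (smult c' f + smult c f')) z / of_int (c * c')"
    using *(1) **(1) by simp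
  thus ?thesis
    unfolding conj_embedding_eq[OF x z assms(1) *] conj_embedding_eq[OF x z assms(2) **]
    using *(1) **(1) by (simp add: add_frac_eq mult.commute)
qed

lemma conj_embedding_mult:
  assumes "y \<in> rat_adjoin {x}" "y' \<in> rat_adjoin {x}"
  shows "conj_embedding x z (y * y') = conj_embedding x z y * conj_embedding x z y'"
proof -
  obtain f c where *: "c \<noteq> 0" "y = poly (ipoly f) x / of_int c"
    using rat_adjoin_int_poly[OF x assms(1)] by blast
  obtain f' c' where **: "c' \<noteq> 0" "y' = poly (ipoly f') x / of_int c'"
    using rat_adjoin_int_poly[OF x assms(2)] by blast
  have "y * y' = poly (ipoly (f * f')) x / of_int (c * c')"
    unfolding *(2) **(2) by simp
  from conj_embedding_eq[OF x z rat_adjoin_mult[OF assms] _ this]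
  have "conj_embedding x z (y * y') = poly (ipoly (f * f')) z / of_int (c * c')"
    using *(1) **(1) by simp
  thus ?thesis
    unfolding conj_embedding_eq[OF x z assms(1) *] conj_embedding_eq[OF x z assms(2) **] by simp
qed

end

lemma conj_embedding_complex_embedding:
  assumes "algebraic x" "z \<in> conjugates x"
  shows "conj_embedding x z \<in> complex_embeddings (rat_adjoin {x})"
  using assms unfolding complex_embeddings_def
  by (auto intro!: ring_hom_memI simp: conj_embedding_1 conj_embedding_add conj_embedding_mult)
    (simp add: conj_embedding_def)

section \<open>Homomorphism properties of arbitrary embeddings\<close>

context
  fixes S \<sigma>
  assumes \<sigma>: "\<sigma> \<in> complex_embeddings (rat_adjoin S)"
begin

lemma complex_embedding_1: "\<sigma> 1 = 1"
  using \<sigma> ring_hom_one[of \<sigma> "complex_ring\<lparr>carrier := rat_adjoin S\<rparr>" complex_ring]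
  by (simp add: complex_embeddings_def)

lemma complex_embedding_add:
  "y \<in> rat_adjoin S \<Longrightarrow> y' \<in> rat_adjoin S \<Longrightarrow> \<sigma> (y + y') = \<sigma> y + \<sigma> y'"
  using \<sigma> ring_hom_add[of \<sigma> "complex_ring\<lparr>carrier := rat_adjoin S\<rparr>" complex_ring y y']
  by (simp add: complex_embeddings_def)

lemma complex_embedding_mult:
  "y \<in> rat_adjoin S \<Longrightarrow> y' \<in> rat_adjoin S \<Longrightarrow> \<sigma> (y * y') = \<sigma> y * \<sigma> y'"
  using \<sigma> ring_hom_mult[of \<sigma> "complex_ring\<lparr>carrier := rat_adjoin S\<rparr>" complex_ring y y']
  by (simp add: complex_embeddings_def)

lemma complex_embedding_0: "\<sigma> 0 = 0"
  using complex_embedding_add[OF zero_in_rat_adjoin zero_in_rat_adjoin] by simp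

lemma complex_embedding_uminus:
  assumes "y \<in> rat_adjoin S"
  shows "\<sigma> (- y) = - \<sigma> y"
  using complex_embedding_add[OF assms rat_adjoin_uminus[OF assms]] complex_embedding_0
  by (simp add: add_eq_0_iff)

lemma complex_embedding_inverse:
  assumes "y \<in> rat_adjoin S" "y \<noteq> 0"
  shows "\<sigma> (inverse y) = inverse (\<sigma> y)"
proof -
  have "\<sigma> y * \<sigma> (inverse y) = 1"
    using complex_embedding_mult[OF assms(1) rat_adjoin_inverse[OF assms(1)]] assms(2)
    by (simp add: complex_embedding_1)
  thus ?thesis by (metis inverse_unique)
qed

lemma complex_embedding_power:
  assumes "y \<in> rat_adjoin S"
  shows "\<sigma> (y ^ n) = \<sigma> y ^ n"
  by (induction n)
    (simp_all add: complex_embedding_1 complex_embedding_mult assms rat_adjoin_power)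

lemma complex_embedding_powi:
  assumes "y \<in> rat_adjoin S" "y \<noteq> 0"
  shows "\<sigma> (y powi k) = \<sigma> y powi k"
  using assms
  by (simp add: power_int_def complex_embedding_power complex_embedding_inverse rat_adjoin_inverse)

lemma complex_embedding_prod:
  assumes "\<And>i. i \<in> A \<Longrightarrow> f i \<in> rat_adjoin S"
  shows "\<sigma> (\<Prod>i\<in>A. f i) = (\<Prod>i\<in>A. \<sigma> (f i))"
  using assms
  by (induction A rule: infinite_finite_induct)
    (simp_all add: complex_embedding_1 complex_embedding_mult rat_adjoin_prod)

lemma complex_embedding_of_int: "of_int a \<in> rat_adjoin S \<and> \<sigma> (of_int a) = of_int a"
proof -
  have nat: "of_nat k \<in> rat_adjoin S \<and> \<sigma> (of_nat k) = of_nat k" for k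
    by (induction k) (simp_all add: zero_in_rat_adjoin one_in_rat_adjoin rat_adjoin_add
        complex_embedding_0 complex_embedding_1 complex_embedding_add)
  show ?thesis
    using nat by (cases a rule: int_cases2) (simp_all add: rat_adjoin_uminus complex_embedding_uminus)
qed

lemma complex_embedding_poly:
  assumes "y \<in> rat_adjoin S"
  shows "poly (ipoly p) y \<in> rat_adjoin S \<and> \<sigma> (poly (ipoly p) y) = poly (ipoly p) (\<sigma> y)"
  by (induction p) (simp_all add: assms zero_in_rat_adjoin complex_embedding_0 complex_embedding_of_int
      rat_adjoin_add rat_adjoin_mult complex_embedding_add complex_embedding_mult)

text \<open>An embedding fixes the integers, hence commutes with integer polynomials and carries
  roots of the minimal polynomial to roots.\<close>

lemma complex_embedding_in_conjugates:
  assumes "y \<in> rat_adjoin S" "algebraic y"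
  shows "\<sigma> y \<in> conjugates y"
  using complex_embedding_poly[OF assms(1), of "int_minpoly y"]
  by (simp add: conjugates_def poly_int_minpoly[OF assms(2)] complex_embedding_0)

end

text \<open>Agreement on the generators spreads through the field operations, and extensionality
  settles the arguments outside the field.\<close>

lemma complex_embedding_eqI:
  assumes \<sigma>: "\<sigma> \<in> complex_embeddings (rat_adjoin S)" and \<tau>: "\<tau> \<in> complex_embeddings (rat_adjoin S)"
    and eq: "\<And>s. s \<in> S \<Longrightarrow> \<sigma> s = \<tau> s"
  shows "\<sigma> = \<tau>"
proof (rule extensionalityI)
  show "\<sigma> \<in> extensional (rat_adjoin S)" "\<tau> \<in> extensional (rat_adjoin S)"
    using \<sigma> \<tau> by (simp_all add: complex_embeddings_def)
  show "\<sigma> y = \<tau> y" if "y \<in> rat_adjoin S" for y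
    using that
    by (induction rule: rat_adjoin_induct)
      (simp_all add: eq complex_embedding_1[OF \<sigma>] complex_embedding_1[OF \<tau>]
        complex_embedding_uminus[OF \<sigma>] complex_embedding_uminus[OF \<tau>]
        complex_embedding_inverse[OF \<sigma>] complex_embedding_inverse[OF \<tau>]
        complex_embedding_add[OF \<sigma>] complex_embedding_add[OF \<tau>]
        complex_embedding_mult[OF \<sigma>] complex_embedding_mult[OF \<tau>])
qed

subsection \<open>Norms and heights\<close>

text \<open>The product of the \<open>X - \<sigma> y\<close> over the embeddings \<open>\<sigma>\<close> of \<open>\<rat>(x)\<close> has rational coefficients.
  All conjugates of \<open>y\<close> are roots of it with the same multiplicity, namely that of the minimal
  polynomial of \<open>y\<close> as a factor.\<close>

lemma card_conj_embedding_fibers: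
  assumes x: "algebraic x" and y: "y \<in> rat_adjoin {x}"
  shows "\<exists>e. \<forall>w\<in>conjugates y. card {z \<in> conjugates x. conj_embedding x z y = w} = e"
proof -
  note y_alg = algebraic_rat_adjoin[OF x y]
  obtain f c where fc: "c \<noteq> 0" "y = poly (ipoly f) x / of_int c"
    using rat_adjoin_int_poly[OF x y] by blast
  define P where "P = (\<Prod>z\<in>conjugates x. [:- conj_embedding x z y, 1:])"
  \<comment> \<open>The factors c X - f(z) replace X - f(z) / c in order to have integer
    coefficients in z and X; this changes \<open>P\<close> only by a scalar.\<close>
  obtain d q where dq: "d \<noteq> 0"
    "smult (of_int d) (\<Prod>z\<in>conjugates x. [:- poly (ipoly f) z, of_int c:]) = ipoly q"
    using conjugates_prod_int_poly[OF x, of "\<lambda>z. [:- poly (ipoly f) z, of_int c:]" "\<lambda>m. [:c * int m:] - f"]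
    by (auto simp: algebra_simps)
  have "(\<Prod>z\<in>conjugates x. [:- poly (ipoly f) z, of_int c:]) =
      (\<Prod>z\<in>conjugates x. smult (of_int c) [:- conj_embedding x z y, 1:])"
    using fc(1) by (intro prod.cong) (simp_all add: conj_embedding_eq[OF x _ y fc])
  also have "\<dots> = smult (of_int c ^ card (conjugates x)) P"
    by (simp only: P_def prod_smult prod_constant)
  finally have q: "ipoly q = smult (of_int d * of_int c ^ card (conjugates x)) P"
    using dq(2) by simp
  have P0: "P \<noteq> 0" using finite_conjugates[OF x] by (simp add: P_def)
  hence "ipoly q \<noteq> 0" using q fc(1) dq(1) by simp
  hence q0: "q \<noteq> 0" by simp
  have "\<not> is_unit (int_minpoly y)"
    using irreducible_int_minpoly[OF y_alg] by (auto simp: irreducible_def)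
  \<comment> \<open>The exponent of the minimal polynomial in \<open>q\<close> will be the common
    fibre size: \<open>r\<close> vanishes at no conjugate of \<open>y\<close>, and each conjugate is
    a simple root of \<open>int_minpoly y\<close>.\<close>
  then obtain r where r: "q = int_minpoly y ^ multiplicity (int_minpoly y) q * r" "\<not> int_minpoly y dvd r"
    using multiplicity_decompose'[OF q0] by metis
  show ?thesis
  proof (intro exI ballI)
    fix w assume w: "w \<in> conjugates y"
    have "card {z \<in> conjugates x. conj_embedding x z y = w} = Polynomial.order w P"
    proof -
      \<comment> \<open>The linear factors of \<open>P\<close> with root \<open>w\<close> are
        exactly those indexed by the fibre over \<open>w\<close>.\<close>
      have "Polynomial.order w P = count (\<Sum>z\<in>conjugates x. {#conj_embedding x z y#}) w"
        using P0 by (simp add: P_def proots_prod flip: count_proots)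
      also have "\<dots> = card {z \<in> conjugates x. conj_embedding x z y = w}"
        using finite_conjugates[OF x]
        by (simp add: count_sum if_distrib sum.If_cases Int_def Collect_conj_eq[symmetric] cong: if_cong)
      finally show ?thesis ..
    qed
    also have "\<dots> = Polynomial.order w (ipoly q)"
      using fc(1) dq(1) by (simp add: q order_smult)
    also have "\<dots> = multiplicity (int_minpoly y) q * Polynomial.order w (ipoly (int_minpoly y)) +
        Polynomial.order w (ipoly r)"
    proof -
      have "ipoly q = ipoly (int_minpoly y) ^ multiplicity (int_minpoly y) q * ipoly r"
        by (subst r(1)) simp
      moreover have "count (proots (ipoly (int_minpoly y) ^ k)) w =
          k * count (proots (ipoly (int_minpoly y))) w" for k
        by (simp add: proots_power)
      ultimately show ?thesis
        using \<open>ipoly q \<noteq> 0\<close> int_minpoly_neq_0[OF y_alg] by (simp add: order_mult)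
    qed
    also have "Polynomial.order w (ipoly r) = 0"
      using r(2) int_minpoly_dvd_iff[OF y_alg w] by (intro order_0I) auto
    also have "Polynomial.order w (ipoly (int_minpoly y)) = 1"
      using rsquarefree_root_order[OF rsquarefree_int_minpoly[OF y_alg]] w int_minpoly_neq_0[OF y_alg]
      by (simp add: conjugates_def)
    finally show "card {z \<in> conjugates x. conj_embedding x z y = w} = multiplicity (int_minpoly y) q"
      by simp
  qed
qed

text \<open>Grouping the embeddings by the image of \<open>y\<close> gives \<open>e\<close> times
  the sum over the conjugates of \<open>y\<close>. The constant function 1 identifies
  \<open>e\<close> as the ratio of the degrees, so multiplying by degrees eliminates it.\<close>

lemma sum_conj_embedding:
  fixes h :: "complex \<Rightarrow> real"
  assumes x: "algebraic x" and y: "y \<in> rat_adjoin {x}"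
  shows "real (alg_degree y) * (\<Sum>z\<in>conjugates x. h (conj_embedding x z y)) =
    real (alg_degree x) * (\<Sum>w\<in>conjugates y. h w)"
proof -
  note y_alg = algebraic_rat_adjoin[OF x y]
  obtain e where e: "\<And>w. w \<in> conjugates y \<Longrightarrow> card {z \<in> conjugates x. conj_embedding x z y = w} = e"
    using card_conj_embedding_fibers[OF x y] by blast
  have sum_fibers: "(\<Sum>z\<in>conjugates x. k (conj_embedding x z y)) = real e * (\<Sum>w\<in>conjugates y. k w)"
    for k :: "complex \<Rightarrow> real"
  proof -
    have "(\<Sum>z\<in>conjugates x. k (conj_embedding x z y)) =
        (\<Sum>w\<in>conjugates y. \<Sum>z\<in>{z \<in> conjugates x. conj_embedding x z y = w}. k (conj_embedding x z y))"
      using finite_conjugates[OF x] finite_conjugates[OF y_alg]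
        complex_embedding_in_conjugates[OF conj_embedding_complex_embedding[OF x] y y_alg]
      by (intro sum.group[symmetric]) auto
    also have "\<dots> = (\<Sum>w\<in>conjugates y. real e * k w)"
      by (intro sum.cong) (simp_all add: e)
    finally show ?thesis by (simp add: sum_distrib_left)
  qed
  have "real (alg_degree x) = real e * real (alg_degree y)"
    using sum_fibers[of "\<lambda>_. 1"] by (simp add: card_conjugates x y_alg)
  thus ?thesis by (simp add: sum_fibers)
qed

text \<open>An embedding of Q(x) is determined by the image of \<open>x\<close>, and
  \<open>conj_embedding\<close> realises every conjugate as such an image.\<close>

lemma field_norm_eq_prod_conjugates:
  assumes x: "algebraic x"
  shows "field_norm (rat_adjoin {x}) x = (\<Prod>z\<in>conjugates x. z)"
proof -
  have "bij_betw (\<lambda>\<sigma>. \<sigma> x) (complex_embeddings (rat_adjoin {x})) (conjugates x)"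
  proof (intro bij_betwI')
    fix \<sigma> \<tau> assume "\<sigma> \<in> complex_embeddings (rat_adjoin {x})" "\<tau> \<in> complex_embeddings (rat_adjoin {x})"
    thus "\<sigma> x = \<tau> x \<longleftrightarrow> \<sigma> = \<tau>" by (auto intro: complex_embedding_eqI)
  next
    fix \<sigma> assume \<sigma>: "\<sigma> \<in> complex_embeddings (rat_adjoin {x})"
    show "\<sigma> x \<in> conjugates x"
      using x by (intro complex_embedding_in_conjugates[OF \<sigma>] rat_adjoin_incl) simp_all
  next
    fix z assume "z \<in> conjugates x"
    thus "\<exists>\<sigma>\<in>complex_embeddings (rat_adjoin {x}). z = \<sigma> x"
      using conj_embedding_complex_embedding[OF x] conj_embedding_self[OF x] by metis
  qed
  from prod.reindex_bij_betw[OF this, of "\<lambda>z. z"] show ?thesis by (simp add: field_norm_def)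
qed

section \<open>Sizes of norms, heights and constant coefficients\<close>

lemma ln_cmod_field_norm:
  assumes "algebraic x" "x \<noteq> 0"
  shows "ln (cmod (field_norm (rat_adjoin {x}) x)) = (\<Sum>z\<in>conjugates x. ln (cmod z))"
  using assms conjugate_neq_0[OF assms]
  by (simp add: field_norm_eq_prod_conjugates ln_prod finite_conjugates flip: prod_norm)

lemma weil_height_ge:
  assumes x: "algebraic x" "x \<noteq> 0"
  shows "\<bar>\<Sum>z\<in>conjugates x. ln (cmod z)\<bar> \<le> real (alg_degree x) * weil_height x"
proof -
  define a c where "a = \<bar>real_of_int (Polynomial.lead_coeff (int_minpoly x))\<bar>"
    and "c = \<bar>real_of_int (Polynomial.coeff (int_minpoly x) 0)\<bar>"
  define s t where "s = (\<Sum>z\<in>conjugates x. ln (cmod z))"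
    and "t = (\<Sum>z\<in>conjugates x. ln (max 1 (cmod z)))"
  have ge_1: "a \<ge> 1" "c \<ge> 1"
    using lead_coeff_int_minpoly[OF x(1)] coeff_0_int_minpoly_neq_0[OF x] by (auto simp: a_def c_def)
  have nz: "z \<noteq> 0" if "z \<in> conjugates x" for z
    using conjugate_neq_0[OF x that] .
  have "c = a * (\<Prod>z\<in>conjugates x. cmod z)"
    using cmod_coeff_0_int_minpoly[OF x(1)] by (simp add: a_def c_def)
  moreover have "(\<Prod>z\<in>conjugates x. cmod z) > 0"
    using nz by (intro prod_pos) auto
  ultimately have "ln c = ln a + ln (\<Prod>z\<in>conjugates x. cmod z)"
    using ge_1 by (simp add: ln_mult)
  also have "ln (\<Prod>z\<in>conjugates x. cmod z) = s"
    using nz finite_conjugates[OF x(1)] by (simp add: s_def ln_prod)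
  finally have c_eq: "ln c = ln a + s" .
  have "(\<Prod>z\<in>conjugates x. max 1 (cmod z)) > 0"
    by (intro prod_pos) auto
  hence "ln (mahler_measure x) = ln a + ln (\<Prod>z\<in>conjugates x. max 1 (cmod z))"
    using ge_1 by (simp add: mahler_measure_def a_def[symmetric] ln_mult)
  also have "ln (\<Prod>z\<in>conjugates x. max 1 (cmod z)) = t"
    unfolding t_def using finite_conjugates[OF x(1)] by (intro ln_prod) auto
  finally have M: "ln (mahler_measure x) = ln a + t" .
  have "s \<le> t" unfolding s_def t_def
    using nz by (intro sum_mono) simp
  moreover have "t \<ge> 0" unfolding t_def by (intro sum_nonneg) simp
  moreover have "ln a \<ge> 0" "ln c \<ge> 0" using ge_1 by simp_all
  \<comment> \<open>Upper bound: \<open>s\<close> is at most \<open>t\<close>, and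
    \<open>ln a\<close> is nonnegative. Lower bound: -s = ln a - ln c is at most
    \<open>ln a\<close>, and \<open>t\<close> is nonnegative.\<close>
  ultimately have "\<bar>s\<bar> \<le> ln (mahler_measure x)" using c_eq M by linarith
  moreover have "alg_degree x > 0"
    using degree_int_minpoly_pos[OF x(1)] by (simp add: alg_degree_def)
  ultimately show ?thesis by (simp add: weil_height_def s_def)
qed

text \<open>The minimal polynomial divides a monic integer polynomial, so its leading coefficient is
  a positive unit of Z.\<close>

lemma lead_coeff_int_minpoly_algebraic_int:
  assumes "algebraic_int x"
  shows "Polynomial.lead_coeff (int_minpoly x) = 1"
proof -
  have x: "algebraic x" using assms by (rule algebraic_int_imp_algebraic)
  obtain p where p: "poly (ipoly p) x = 0" "Polynomial.lead_coeff p = 1"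
    using assms by (auto simp: algebraic_int_altdef_ipoly)
  obtain r where "p = int_minpoly x * r"
    using p(1) int_minpoly_dvd_iff[OF x self_in_conjugates[OF x]] by (auto elim: dvdE)
  hence "Polynomial.lead_coeff (int_minpoly x) * Polynomial.lead_coeff r = 1"
    using p(2) by (simp add: lead_coeff_mult)
  thus ?thesis
    using lead_coeff_int_minpoly[OF x] by (simp add: pos_zmult_eq_1_iff)
qed

text \<open>Up to sign the norm is the constant coefficient \<open>c\<close> of the monic minimal
  polynomial. If \<open>c\<close> were 1 or -1, the reversed polynomial would show that the inverse
  of \<open>x\<close> is an algebraic integer.\<close>

lemma cmod_field_norm_nonunit:
  assumes "algebraic_int x" "x \<noteq> 0" "\<not> algebraic_unit x"
  shows "cmod (field_norm (rat_adjoin {x}) x) \<ge> 2"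
proof -
  have x: "algebraic x" using assms(1) by (rule algebraic_int_imp_algebraic)
  define c where "c = Polynomial.coeff (int_minpoly x) 0"
  have norm: "cmod (field_norm (rat_adjoin {x}) x) = \<bar>real_of_int c\<bar>"
    using cmod_coeff_0_int_minpoly[OF x] lead_coeff_int_minpoly_algebraic_int[OF assms(1)]
    by (simp add: field_norm_eq_prod_conjugates[OF x] c_def prod_norm)
  have "c \<noteq> 0" using coeff_0_int_minpoly_neq_0[OF x assms(2)] by (simp add: c_def)
  moreover have "\<bar>c\<bar> \<noteq> 1"
  proof
    assume "\<bar>c\<bar> = 1"
    have "algebraic_int (inverse x)"
    proof (rule algebraic_int_inverse)
      \<comment> \<open>Scaling by \<open>c\<close> normalises the constant coefficient to c * c =
        1, as \<open>algebraic_int_inverse\<close> demands.\<close>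
      show "poly (ipoly (smult c (int_minpoly x))) x = 0" by (simp add: poly_int_minpoly[OF x])
      show "\<forall>i. Polynomial.coeff (ipoly (smult c (int_minpoly x))) i \<in> \<int>" by simp
      have "c * c = 1" using \<open>\<bar>c\<bar> = 1\<close> by (auto simp: abs_if split: if_splits)
      thus "Polynomial.coeff (ipoly (smult c (int_minpoly x))) 0 = 1"
        by (simp add: c_def[symmetric] flip: of_int_mult)
    qed
    hence "algebraic_unit x"
      using assms(1,2) unfolding algebraic_unit_def by (intro conjI exI[of _ "inverse x"]) auto
    thus False using assms(3) by blast
  qed
  ultimately have "\<bar>c\<bar> \<ge> 2" by linarith
  thus ?thesis unfolding norm by linarith
qed

text \<open>Serves to exclude \<beta> = 0 when the degree is at least 3.\<close>

lemma alg_degree_0: "alg_degree 0 \<le> 1"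
proof -
  have "int_minpoly 0 dvd [:0, 1:]"
    using int_minpoly_dvd_iff[OF _ self_in_conjugates, of 0] by simp
  from dvd_imp_degree_le[OF this] show ?thesis by (simp add: alg_degree_def)
qed

section \<open>Heights of power products of conjugates\<close>

lemma weil_height_conjugates_prod_ge:
  assumes \<beta>: "algebraic \<beta>" "\<beta> \<noteq> 0" and b: "bij_betw b I (conjugates \<beta>)"
    and \<alpha>: "\<alpha> = (\<Prod>i\<in>I. b i powi a i)" and field: "b ` I \<subseteq> rat_adjoin {\<alpha>}"
  shows "\<bar>real_of_int (\<Sum>i\<in>I. a i)\<bar> / real (alg_degree \<beta>) *
    ln (cmod (field_norm (rat_adjoin {\<beta>}) \<beta>)) \<le> weil_height \<alpha>"
proof -
  define n d where "n = real (alg_degree \<beta>)" and "d = real (alg_degree \<alpha>)"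
  define L where "L = ln (cmod (field_norm (rat_adjoin {\<beta>}) \<beta>))"
  have b_conj: "b i \<in> conjugates \<beta>" if "i \<in> I" for i
    using b that by (auto dest: bij_betwE)
  have b_nz: "b i \<noteq> 0" if "i \<in> I" for i
    using conjugate_neq_0[OF \<beta> b_conj[OF that]] .
  have b_mem: "b i \<in> rat_adjoin {\<alpha>}" if "i \<in> I" for i
    using field that by blast
  have fin: "finite I"
    using b finite_conjugates[OF \<beta>(1)] bij_betw_finite by blast
  have \<alpha>_alg: "algebraic \<alpha>"
    unfolding \<alpha> using algebraic_conjugate[OF \<beta>(1)] b_conj
    by (intro algebraic_prod algebraic_powi) auto
  have \<alpha>_nz: "\<alpha> \<noteq> 0"
    unfolding \<alpha> using b_nz fin by (simp add: power_int_eq_0_iff)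
  have pos: "n > 0" "d > 0"
    using degree_int_minpoly_pos \<beta>(1) \<alpha>_alg by (auto simp: n_def d_def alg_degree_def)
  \<comment> \<open>Apply the embedding sending \<alpha> to \<open>z\<close> to the power product
    and take logarithms; it acts on each \<open>b i\<close> because these lie in
    Q(\<alpha>).\<close>
  have ln_z: "ln (cmod z) = (\<Sum>i\<in>I. of_int (a i) * ln (cmod (conj_embedding \<alpha> z (b i))))"
    if z: "z \<in> conjugates \<alpha>" for z
  proof -
    note emb = conj_embedding_complex_embedding[OF \<alpha>_alg z]
    have emb_nz: "conj_embedding \<alpha> z (b i) \<noteq> 0" if "i \<in> I" for i
      using complex_embedding_in_conjugates[OF emb b_mem[OF that] algebraic_conjugate[OF \<beta>(1) b_conj[OF that]]]
        conjugate_neq_0[OF algebraic_conjugate[OF \<beta>(1) b_conj[OF that]] b_nz[OF that]] by blast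
    have "z = conj_embedding \<alpha> z (\<Prod>i\<in>I. b i powi a i)"
      using conj_embedding_self[OF \<alpha>_alg z] \<alpha> by simp
    also have "\<dots> = (\<Prod>i\<in>I. conj_embedding \<alpha> z (b i) powi a i)"
      using b_mem b_nz
      by (subst complex_embedding_prod[OF emb])
        (auto intro!: prod.cong simp: complex_embedding_powi[OF emb] rat_adjoin_powi)
    finally have "cmod z = (\<Prod>i\<in>I. cmod (conj_embedding \<alpha> z (b i)) powi a i)"
      by (metis (no_types, lifting) norm_power_int prod.cong prod_norm)
    also have "ln \<dots> = (\<Sum>i\<in>I. ln (cmod (conj_embedding \<alpha> z (b i)) powi a i))"
      using emb_nz fin by (intro ln_prod) auto
    also have "\<dots> = (\<Sum>i\<in>I. of_int (a i) * ln (cmod (conj_embedding \<alpha> z (b i))))"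
      using emb_nz by (intro sum.cong) (auto simp: power_int_def ln_realpow ln_inverse)
    finally show ?thesis .
  qed
  \<comment> \<open>Every \<open>b i\<close> has the same minimal polynomial as \<beta>, so the sum
    over the embeddings does not depend on \<open>i\<close>.\<close>
  have sum_emb: "n * (\<Sum>z\<in>conjugates \<alpha>. ln (cmod (conj_embedding \<alpha> z (b i)))) = d * L" if "i \<in> I" for i
    using sum_conj_embedding[OF \<alpha>_alg b_mem[OF that], of "\<lambda>w. ln (cmod w)"]
      int_minpoly_conjugate[OF \<beta>(1) b_conj[OF that]]
    by (simp add: n_def d_def L_def ln_cmod_field_norm[OF \<beta>] alg_degree_def conjugates_def)
  \<comment> \<open>Interchanging the sums isolates each exponent \<open>a i\<close>, which then
    multiplies the same quantity \<open>d * L\<close>.\<close>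
  have "n * (\<Sum>z\<in>conjugates \<alpha>. ln (cmod z)) =
      n * (\<Sum>i\<in>I. of_int (a i) * (\<Sum>z\<in>conjugates \<alpha>. ln (cmod (conj_embedding \<alpha> z (b i)))))"
    by (simp add: ln_z sum_distrib_left sum.swap[of _ I])
  also have "\<dots> = (\<Sum>i\<in>I. of_int (a i) * (n * (\<Sum>z\<in>conjugates \<alpha>. ln (cmod (conj_embedding \<alpha> z (b i))))))"
    by (simp add: sum_distrib_left mult_ac)
  also have "\<dots> = (\<Sum>i\<in>I. of_int (a i) * (d * L))"
    by (intro sum.cong) (simp_all add: sum_emb)
  also have "\<dots> = of_int (\<Sum>i\<in>I. a i) * (d * L)"
    by (simp add: sum_distrib_right)
  finally have "(\<Sum>z\<in>conjugates \<alpha>. ln (cmod z)) = of_int (\<Sum>i\<in>I. a i) / n * L * d"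
    using pos by (simp add: field_simps)
  hence "\<bar>of_int (\<Sum>i\<in>I. a i) / n * L\<bar> * d \<le> weil_height \<alpha> * d"
    using weil_height_ge[OF \<alpha>_alg \<alpha>_nz] pos by (simp add: abs_mult d_def mult_ac)
  hence "\<bar>of_int (\<Sum>i\<in>I. a i) / n * L\<bar> \<le> weil_height \<alpha>"
    using pos(2) by (rule mult_right_le_imp_le)
  \<comment> \<open>Dropping the absolute value around \<open>L\<close> can only decrease the
    bound.\<close>
  moreover have "\<bar>of_int (\<Sum>i\<in>I. a i)\<bar> / n * L \<le> \<bar>of_int (\<Sum>i\<in>I. a i) / n * L\<bar>"
    using pos by (simp add: abs_mult mult_left_mono divide_right_mono)
  ultimately show ?thesis unfolding n_def L_def by linarith
qed

theorem theorem1p3: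
  shows
    "(\<forall>(n::nat) (\<beta>::complex) (b :: nat \<Rightarrow> complex) (a :: nat \<Rightarrow> int) (\<alpha>::complex).
        n \<ge> 3 \<and>
        algebraic_int \<beta> \<and> alg_degree \<beta> = n \<and>
        bij_betw b {1..n} (conjugates \<beta>) \<and>
        \<alpha> = (\<Prod>i=1..n. b i powi a i) \<and>
        rat_adjoin {\<alpha>} = rat_adjoin (b ` {1..n})
        \<longrightarrow>
        weil_height \<alpha> \<ge>
          (1 / real n * \<bar>real_of_int (\<Sum>i=1..n. a i)\<bar>) *
          ln (cmod (field_norm (rat_adjoin {\<beta>}) \<beta>)))
     \<and>
     (\<forall>(\<beta> :: nat \<Rightarrow> complex) (b :: nat \<Rightarrow> nat \<Rightarrow> complex) (a :: nat \<Rightarrow> nat \<Rightarrow> int)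
       (\<alpha> :: nat \<Rightarrow> complex).
        (\<forall>n\<ge>3.
          algebraic_int (\<beta> n) \<and> alg_degree (\<beta> n) = n \<and>
          bij_betw (b n) {1..n} (conjugates (\<beta> n)) \<and>
          \<alpha> n = (\<Prod>i=1..n. b n i powi a n i) \<and>
          rat_adjoin {\<alpha> n} = rat_adjoin (b n ` {1..n}) \<and>
          \<not> algebraic_unit (\<beta> n)) \<and>
        filterlim (\<lambda>n. 1 / real n * \<bar>real_of_int (\<Sum>i=1..n. a n i)\<bar>) at_top sequentially
        \<longrightarrow>
        filterlim (\<lambda>n. weil_height (\<alpha> n)) at_top sequentially)"
proof (intro conjI allI impI; (elim conjE)?)
  fix n :: nat and \<beta> \<alpha> :: complex and b :: "nat \<Rightarrow> complex" and a :: "nat \<Rightarrow> int"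
  assume n: "n \<ge> 3" "alg_degree \<beta> = n" and \<beta>: "algebraic_int \<beta>"
    and b: "bij_betw b {1..n} (conjugates \<beta>)" and \<alpha>: "\<alpha> = (\<Prod>i=1..n. b i powi a i)"
    and field: "rat_adjoin {\<alpha>} = rat_adjoin (b ` {1..n})"
  \<comment> \<open>The number 0 has degree at most 1, while here the degree is at least 3.\<close>
  have "\<beta> \<noteq> 0" using n alg_degree_0 by auto
  moreover have "b ` {1..n} \<subseteq> rat_adjoin {\<alpha>}"
    unfolding field by (auto intro: rat_adjoin_incl)
  ultimately show "weil_height \<alpha> \<ge> (1 / real n * \<bar>real_of_int (\<Sum>i=1..n. a i)\<bar>) *
      ln (cmod (field_norm (rat_adjoin {\<beta>}) \<beta>))"
    using weil_height_conjugates_prod_ge[OF _ _ b \<alpha>] \<beta> n(2) by (simp add: algebraic_int_imp_algebraic)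
next
  fix \<beta> \<alpha> :: "nat \<Rightarrow> complex" and b :: "nat \<Rightarrow> nat \<Rightarrow> complex" and a :: "nat \<Rightarrow> nat \<Rightarrow> int"
  assume data: "\<forall>n\<ge>3. algebraic_int (\<beta> n) \<and> alg_degree (\<beta> n) = n \<and>
      bij_betw (b n) {1..n} (conjugates (\<beta> n)) \<and> \<alpha> n = (\<Prod>i=1..n. b n i powi a n i) \<and>
      rat_adjoin {\<alpha> n} = rat_adjoin (b n ` {1..n}) \<and> \<not> algebraic_unit (\<beta> n)"
    and lim: "filterlim (\<lambda>n. 1 / real n * \<bar>real_of_int (\<Sum>i=1..n. a n i)\<bar>) at_top sequentially"
  show "filterlim (\<lambda>n. weil_height (\<alpha> n)) at_top sequentially"
  proof (rule filterlim_at_top_mono)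
    \<comment> \<open>The constant \<open>ln 2\<close> comes from the norm of a nonunit having
      absolute value at least 2.\<close>
    show "filterlim (\<lambda>n. (1 / real n * \<bar>real_of_int (\<Sum>i=1..n. a n i)\<bar>) * ln 2) at_top sequentially"
      by (rule filterlim_at_top_mult_tendsto_pos[OF tendsto_const _ lim]) simp
    show "\<forall>\<^sub>F n in sequentially.
        (1 / real n * \<bar>real_of_int (\<Sum>i=1..n. a n i)\<bar>) * ln 2 \<le> weil_height (\<alpha> n)"
      \<comment> \<open>The data are constrained from n = 3 on, which suffices for an eventual
        bound.\<close>
      using eventually_ge_at_top[of 3]
    proof eventually_elim
      case (elim n)
      define s where "s = 1 / real n * \<bar>real_of_int (\<Sum>i=1..n. a n i)\<bar>"
      have \<beta>: "algebraic_int (\<beta> n)" "alg_degree (\<beta> n) = n" "\<not> algebraic_unit (\<beta> n)"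
        and b: "bij_betw (b n) {1..n} (conjugates (\<beta> n))"
        and \<alpha>: "\<alpha> n = (\<Prod>i=1..n. b n i powi a n i)"
        and field: "rat_adjoin {\<alpha> n} = rat_adjoin (b n ` {1..n})"
        using data elim by auto
      have nz: "\<beta> n \<noteq> 0"
      proof
        assume "\<beta> n = 0"
        with \<beta>(2) elim alg_degree_0 show False by simp
      qed
      have "b n ` {1..n} \<subseteq> rat_adjoin {\<alpha> n}"
        unfolding field by (auto intro: rat_adjoin_incl)
      hence "s * ln (cmod (field_norm (rat_adjoin {\<beta> n}) (\<beta> n))) \<le> weil_height (\<alpha> n)"
        using weil_height_conjugates_prod_ge[OF _ nz b \<alpha>] \<beta>(1,2)
        by (simp add: algebraic_int_imp_algebraic s_def)
      moreover have "s * ln 2 \<le> s * ln (cmod (field_norm (rat_adjoin {\<beta> n}) (\<beta> n)))"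
        using cmod_field_norm_nonunit[OF \<beta>(1) nz \<beta>(3)]
        by (intro mult_left_mono ln_mono) (simp_all add: s_def)
      ultimately show ?case unfolding s_def by linarith
    qed
  qed
qed

end
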